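(* Let $R$ be a commutative ring with identity. Then the following statements are equivalent: (1) $R$ is a von Neumann regular ring; (2) $R$ is a $u$-$\mathfrak{p}$-von Neumann regular ring for any $\mathfrak{p}\in\mathrm{Spec}(R)$; (3) $R$ is a $u$-$\mathfrak{m}$-von Neumann regular ring for any $\mathfrak{m}\in\mathrm{Max}(R)$.
   Context: $\mathrm{Spec}(R)$ and $\mathrm{Max}(R)$ are the sets of prime and maximal ideals of $R$. $R$ is von Neumann regular if for any $a\in R$ there is $r\in R$ with $a=ra^2$. For a multiplicative subset $S$ of $R$ (i.e. $1\in S$ and $S$ is closed under products), $R$ is $u$-$S$-von Neumann regular if there exists $s\in S$ such that for any $a\in R$ there exists $r\in R$ with $sa=ra^2$. For a prime ideal $\mathfrak{p}$ of $R$, $R$ is $u$-$\mathfrak{p}$-von Neumann regular if it is $u$-$(R\setminus\mathfrak{p})$-von Neumann regular. *)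

theory Defs
  imports "HOL-Algebra.Ideal"
begin

definition Spec :: "('a, 'b) ring_scheme \<Rightarrow> 'a set set" where
  "Spec R = {P. primeideal P R}"

definition Max_Spec :: "('a, 'b) ring_scheme \<Rightarrow> 'a set set" where
  "Max_Spec R = {M. maximalideal M R}"

definition von_neumann_regular :: "('a, 'b) ring_scheme \<Rightarrow> bool" where
  "von_neumann_regular R \<longleftrightarrow>
     (\<forall>a \<in> carrier R. \<exists>r \<in> carrier R. a = r \<otimes>\<^bsub>R\<^esub> a [^]\<^bsub>R\<^esub> (2::nat))"

(* Intended for multiplicative subsets S, i.e. submonoid S R. The element s is
   uniform: it is chosen before a. *)
definition u_S_von_neumann_regular :: "'a set \<Rightarrow> ('a, 'b) ring_scheme \<Rightarrow> bool" where
  "u_S_von_neumann_regular S R \<longleftrightarrow>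
     (\<exists>s \<in> S. \<forall>a \<in> carrier R. \<exists>r \<in> carrier R.
        s \<otimes>\<^bsub>R\<^esub> a = r \<otimes>\<^bsub>R\<^esub> a [^]\<^bsub>R\<^esub> (2::nat))"

definition u_prime_von_neumann_regular :: "'a set \<Rightarrow> ('a, 'b) ring_scheme \<Rightarrow> bool" where
  "u_prime_von_neumann_regular P R \<longleftrightarrow> u_S_von_neumann_regular (carrier R - P) R"

lemma submonoid_compl_Spec:
  assumes "P \<in> Spec R"
  shows "submonoid (carrier R - P) R"
proof -
  interpret primeideal P R
    using assms by (simp add: Spec_def)
  show ?thesis
    using I_prime I_notcarr one_imp_carrier by unfold_locales auto
qed

lemma Max_Spec_subset_Spec:
  assumes "cring R"
  shows "Max_Spec R \<subseteq> Spec R"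
  using cring.maximalideal_prime[OF assms] by (auto simp: Max_Spec_def Spec_def)

end

theory Submission
  imports Defs "HOL-Algebra.Ring_Divisibility"
begin

text \<open>
  For \<open>(1) \<Longrightarrow> (2)\<close> the uniform element \<open>s = 1\<close> works at every prime, and \<open>(2) \<Longrightarrow> (3)\<close> holds because
  maximal ideals are prime.  The content is \<open>(3) \<Longrightarrow> (1)\<close>: for a fixed \<open>a\<close>, the elements \<open>s\<close> for
  which \<open>s a\<close> is a multiple of \<open>a\<^sup>2\<close> form the ideal quotient \<open>(a\<^sup>2) : (a)\<close>
  (\<open>square_quotient_ideal\<close>).  By (3) no maximal ideal contains it.  Every proper ideal lies in a
  maximal one (\<open>proper_ideal_subset_maximalideal\<close>), so the quotient is the whole ring
  and contains \<open>1\<close>, that is, \<open>a\<close> itself is a multiple of \<open>a\<^sup>2\<close>.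
\<close>

text \<open>
  Krull's theorem, by Zorn's lemma: an ideal is proper exactly when it omits \<open>\<one>\<close>, and this survives
  unions of chains.
\<close>
lemma (in ring) proper_ideal_subset_maximalideal:
  assumes I: "ideal I R" and proper: "\<one> \<notin> I"
  obtains M where "maximalideal M R" "I \<subseteq> M"
proof -
  let ?S = "{J. ideal J R \<and> I \<subseteq> J \<and> \<one> \<notin> J}"
  have "\<exists>M\<in>?S. \<forall>X\<in>?S. M \<subseteq> X \<longrightarrow> X = M"
  proof (rule subset_Zorn_nonempty)
    show "?S \<noteq> {}"
      using I proper by blast
  next
    fix C assume ne: "C \<noteq> {}" and C: "subset.chain ?S C"
    then have "subset.chain {J. ideal J R} C"
      unfolding pred_on.chain_def by blast
    then have "ideal (\<Union>C) R"
      using chain_Union_is_ideal[of C] ne by simp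
    moreover have "\<forall>J \<in> C. I \<subseteq> J \<and> \<one> \<notin> J"
      using C unfolding pred_on.chain_def by blast
    then have "I \<subseteq> \<Union>C" "\<one> \<notin> \<Union>C"
      using ne by (simp_all add: less_eq_Sup)
    ultimately show "\<Union>C \<in> ?S"
      by simp
  qed
  then obtain M where "M \<in> ?S" and max: "\<forall>X\<in>?S. M \<subseteq> X \<longrightarrow> X = M"
    by (rule bexE)
  then have M: "ideal M R" "I \<subseteq> M" "\<one> \<notin> M"
    by simp_all
  have "maximalideal M R"
  proof (rule maximalidealI[OF M(1)])
    show "carrier R \<noteq> M"
      using M(3) by blast
    show "J = M \<or> J = carrier R" if J: "ideal J R" "M \<subseteq> J" for J
    proof (cases "\<one> \<in> J")
      case True
      then show ?thesis
        using ideal.one_imp_carrier[OF J(1)] by simp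
    next
      case False
      then have "J \<in> ?S"
        using J M(2) by simp
      then show ?thesis
        using max J(2) by simp
    qed
  qed
  then show thesis
    using M(2) by (rule that)
qed

text \<open>
  The set is the preimage of the principal ideal \<open>(a\<^sup>2)\<close> under multiplication by \<open>a\<close>.
\<close>
lemma (in cring) square_quotient_ideal:
  assumes a: "a \<in> carrier R"
  shows "ideal {s \<in> carrier R. \<exists>r \<in> carrier R. s \<otimes> a = r \<otimes> a [^] (2::nat)} R"
proof -
  have "ideal {s \<in> carrier R. a \<otimes> s \<in> PIdl (a [^] (2::nat))} R"
    using a by (intro ideal.helper_max_prime cgenideal_ideal is_cring) simp_all
  also have "{s \<in> carrier R. a \<otimes> s \<in> PIdl (a [^] (2::nat))}
      = {s \<in> carrier R. \<exists>r \<in> carrier R. s \<otimes> a = r \<otimes> a [^] (2::nat)}"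
    using a by (auto simp: cgenideal_def m_comm)
  finally show ?thesis .
qed

lemma (in cring) von_neumann_regular_imp_u_prime:
  assumes "von_neumann_regular R" and "P \<in> Spec R"
  shows "u_prime_von_neumann_regular P R"
proof -
  have "\<one> \<in> carrier R - P"
    using submonoid.one_closed[OF submonoid_compl_Spec[OF assms(2)]] .
  moreover have "\<forall>a \<in> carrier R. \<exists>r \<in> carrier R. \<one> \<otimes> a = r \<otimes> a [^] (2::nat)"
    using assms(1) by (simp add: von_neumann_regular_def)
  ultimately show ?thesis
    unfolding u_prime_von_neumann_regular_def u_S_von_neumann_regular_def by blast
qed

text \<open>
  The hypothesis at a maximal ideal \<open>M\<close> provides an element of \<open>(a\<^sup>2) : (a)\<close> outside \<open>M\<close>; as this
  happens at every \<open>M\<close>, the quotient cannot be proper.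
\<close>
lemma (in cring) u_maximal_imp_von_neumann_regular:
  assumes "\<forall>M \<in> Max_Spec R. u_prime_von_neumann_regular M R"
  shows "von_neumann_regular R"
  unfolding von_neumann_regular_def
proof
  fix a assume a: "a \<in> carrier R"
  let ?Q = "{s \<in> carrier R. \<exists>r \<in> carrier R. s \<otimes> a = r \<otimes> a [^] (2::nat)}"
  have "\<one> \<in> ?Q"
  proof (rule ccontr)
    assume "\<one> \<notin> ?Q"
    then obtain M where M: "maximalideal M R" "?Q \<subseteq> M"
      by (rule proper_ideal_subset_maximalideal[OF square_quotient_ideal[OF a]])
    then have "u_prime_von_neumann_regular M R"
      using assms by (simp add: Max_Spec_def)
    then obtain s where "s \<in> carrier R - M" "s \<in> ?Q"
      using a unfolding u_prime_von_neumann_regular_def u_S_von_neumann_regular_def by blast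
    with M(2) show False
      by blast
  qed
  then show "\<exists>r \<in> carrier R. a = r \<otimes> a [^] (2::nat)"
    using a by simp
qed

theorem proposition3p19:
  fixes R :: "('a, 'b) ring_scheme"
  assumes "cring R"
  shows "(von_neumann_regular R \<longleftrightarrow> (\<forall>P \<in> Spec R. u_prime_von_neumann_regular P R))
    \<and> ((\<forall>P \<in> Spec R. u_prime_von_neumann_regular P R)
         \<longleftrightarrow> (\<forall>M \<in> Max_Spec R. u_prime_von_neumann_regular M R))"
  using cring.von_neumann_regular_imp_u_prime[OF assms]
    cring.u_maximal_imp_von_neumann_regular[OF assms] Max_Spec_subset_Spec[OF assms]
  by blast

end
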